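(* Let $G\subset S_n$ and let $N\triangleleft G$ be a proper normal subgroup. Let $\pi$ be a minimal element (in $\Pi_n$) of the set $\{\varphi(g): g\in G\setminus N\}$ of partitions associated with elements of $G$ that are not in $N$. Then: (1) the group $G_\pi^BN/N$ is cyclic of prime order, say $p$; (2) any element $g$ of $G\setminus N$ whose orbits are given by $\pi$ (i.e. $\varphi(g)=\pi$) has order a power of $p$; and (3) the image of any such $g$ in $G/N$ generates $G_\pi^BN/N$.
   Context: $\Pi_n$ is the poset of partitions of the set $[n]=\{1,\dots,n\}$, ordered by $\pi\leq\tau$ if and only if $\pi$ refines $\tau$. The map $\varphi: G\to\Pi_n$ sends $g$ to the partition of $[n]$ into the orbits of $\langle g\rangle$. For $\pi\in\Pi_n$, $G_\pi^B$ is the blockwise stabilizer of $\pi$ in $G$, i.e. the subgroup of elements of $G$ mapping each block of $\pi$ to itself. $G_\pi^BN/N$ denotes the image of $G_\pi^B$ in $G/N$. *)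

theory Defs
  imports
    "HOL-Library.Disjoint_Sets"
    "HOL-Computational_Algebra.Primes"
    "HOL-Algebra.Sym_Groups"
    "HOL-Algebra.Group_Action"
    "HOL-Algebra.Elementary_Groups"
    "HOL-Algebra.Multiplicative_Group"
begin

abbreviation perm_group :: "nat \<Rightarrow> (nat \<Rightarrow> nat) set \<Rightarrow> (nat \<Rightarrow> nat) monoid"
  where "perm_group n G \<equiv> (sym_group n)\<lparr>carrier := G\<rparr>"

text \<open>The map \<open>\<phi>\<close>. The action is the natural one, so its
  structure map is the identity.\<close>

definition orbit_partition :: "nat \<Rightarrow> (nat \<Rightarrow> nat) \<Rightarrow> nat set set"
  where "orbit_partition n g =
    orbits (perm_group n (generate (sym_group n) {g})) {1..n} (\<lambda>h. h)"

text \<open>Minimality in the poset of partitions of \<open>{1..n}\<close>, in which smaller means finer.\<close>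

definition minimal_partition :: "nat \<Rightarrow> nat set set set \<Rightarrow> nat set set \<Rightarrow> bool"
  where "minimal_partition n S \<pi> \<longleftrightarrow>
    \<pi> \<in> S \<and> (\<forall>\<tau>\<in>S. refines {1..n} \<tau> \<pi> \<longrightarrow> \<tau> = \<pi>)"

definition blockwise_stabilizer :: "(nat \<Rightarrow> nat) set \<Rightarrow> nat set set \<Rightarrow> (nat \<Rightarrow> nat) set"
  where "blockwise_stabilizer G \<pi> = {g \<in> G. \<forall>B\<in>\<pi>. g ` B = B}"

text \<open>The image \<open>HN/N\<close> of a subgroup \<open>H\<close> in \<open>G/N\<close>, with the operations
  inherited from \<open>G/N\<close>.\<close>

definition quotient_image :: "('a, 'b) monoid_scheme \<Rightarrow> 'a set \<Rightarrow> 'a set \<Rightarrow> 'a set monoid"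
  where "quotient_image G N H = (G Mod N)\<lparr>carrier := (\<lambda>h. N #>\<^bsub>G\<^esub> h) ` H\<rparr>"

end

theory Submission
  imports Defs
begin

text \<open>An element of the blockwise stabilizer of \<open>\<pi>\<close> has orbits refining \<open>\<pi>\<close>, so by
  minimality it lies in \<open>N\<close> or its orbits are exactly the blocks of \<open>\<pi>\<close>. Fix \<open>g\<close> outside \<open>N\<close>
  with orbits \<open>\<pi>\<close> and a point \<open>x\<close> moved by \<open>g\<close>. Any \<open>h\<close> in the stabilizer maps \<open>x\<close> to some
  \<open>g\<^sup>i x\<close>; then \<open>g\<^sup>-\<^sup>i h\<close> is in the stabilizer and fixes \<open>x\<close>, hence lies in \<open>N\<close>, so the coset of
  \<open>g\<close> generates the image of the stabilizer. For every prime \<open>q\<close> dividing the order of \<open>g\<close>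
  also \<open>g\<^sup>q\<close> lies in \<open>N\<close>, so \<open>q\<close> is the order of that coset; thus only one prime \<open>q\<close> occurs.\<close>

section \<open>Powers and orbits of a single permutation\<close>

lemma perm_group_pow:
  fixes k :: nat
  shows "g [^]\<^bsub>perm_group n G\<^esub> k = g ^^ k"
  by (induction k) (simp_all add: sym_group_def fun_eq_iff funpow_swap1)

lemma perm_group_mult: "g \<otimes>\<^bsub>perm_group n G\<^esub> h = g \<circ> h"
  by (simp add: sym_group_def)

lemma perm_group_one: "\<one>\<^bsub>perm_group n G\<^esub> = id"
  by (simp add: sym_group_def)

lemma finite_sym_group: "finite (carrier (sym_group n))"
  by (simp add: sym_group_def finite_permutations)

text \<open>In a finite group inverses are themselves positive powers, so orbits can be described by
  the iterates \<open>g ^^ k\<close> with natural \<open>k\<close> alone.\<close>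

lemma generate_sym_group:
  assumes "g permutes {1..n}"
  shows "generate (sym_group n) {g} = range (\<lambda>k. g ^^ k)"
proof -
  interpret S: group "sym_group n" by (rule sym_group_is_group)
  have "g [^]\<^bsub>sym_group n\<^esub> k = g ^^ k" for k :: nat
    by (induction k) (simp_all add: sym_group_def fun_eq_iff funpow_swap1)
  then show ?thesis
    using S.generate_pow_on_finite_carrier[OF finite_sym_group] assms
    by (auto simp: sym_group_carrier)
qed

lemma orbit_partition_eq:
  assumes "g permutes {1..n}"
  shows "orbit_partition n g = (\<lambda>x. range (\<lambda>k. (g ^^ k) x)) ` {1..n}"
  unfolding orbit_partition_def orbits_def orbit_def generate_sym_group[OF assms]
  by (simp add: image_image Setcompr_eq_image del: atLeastAtMost_iff)

lemma funpow_permutes: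
  assumes "g permutes A"
  shows "(g ^^ k) permutes A"
proof (induction k)
  case 0
  then show ?case by (simp add: permutes_id flip: id_def)
next
  case (Suc k)
  then show ?case using permutes_compose[OF Suc assms] by (simp add: comp_def)
qed

text \<open>A permutation of a finite set has finite order, so iterating forward from
  \<open>y\<close> eventually returns to \<open>x\<close>. Forward orbits therefore behave like
  equivalence classes.\<close>

lemma funpow_orbit_sym:
  assumes "g permutes A" "finite A" "y \<in> range (\<lambda>k. (g ^^ k) x)"
  shows "range (\<lambda>k. (g ^^ k) y) = range (\<lambda>k. (g ^^ k) x)"
proof -
  obtain i where y: "y = (g ^^ i) x" using assms(3) by blast
  have "permutation g" using assms permutation_permutes by blast
  then obtain m where m: "g ^^ m = id" "m > 0"
    using permutation_is_nilpotent by blast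
  have per: "g ^^ (m * j) = id" for j
    by (simp add: m(1) funpow_mult[symmetric])
  have 1: "(g ^^ k) y = (g ^^ (k + i)) x" for k
    by (simp add: y funpow_add)
  \<comment> \<open>Since \<open>y\<close> is \<open>i\<close> steps after \<open>x\<close>, another
    \<open>m * i - i\<close> steps complete \<open>i\<close> full periods and lead back to
    \<open>x\<close>. The subtraction does not truncate because \<open>m > 0\<close>.\<close>
  have 2: "(g ^^ k) x = (g ^^ (k + (m * i - i))) y" for k
  proof -
    have "k + (m * i - i) + i = k + m * i"
      using m(2) by (cases m) simp_all
    then have "(g ^^ (k + (m * i - i))) y = (g ^^ (k + m * i)) x"
      unfolding 1 by presburger
    then show ?thesis by (simp add: funpow_add[of k "m * i"] per)
  qed
  show ?thesis
    using 1 2 by (intro subset_antisym image_subsetI) auto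
qed

lemma partition_on_orbit_partition:
  assumes "g permutes {1..n}"
  shows "partition_on {1..n} (orbit_partition n g)"
proof (rule partition_onI)
  have "(g ^^ k) x \<in> {1..n}" if "x \<in> {1..n}" for x k
    using permutes_in_image[OF funpow_permutes[OF assms]] that by simp
  moreover have "x \<in> range (\<lambda>k. (g ^^ k) x)" for x
    by (metis funpow_0 rangeI)
  ultimately show "\<Union> (orbit_partition n g) = {1..n}"
    unfolding orbit_partition_eq[OF assms] by blast
next
  fix A B assume "A \<in> orbit_partition n g" "B \<in> orbit_partition n g" and neq: "A \<noteq> B"
  then obtain x y where xy: "A = range (\<lambda>k. (g ^^ k) x)" "B = range (\<lambda>k. (g ^^ k) y)"
    unfolding orbit_partition_eq[OF assms] by blast
  have "A = B" if "z \<in> A" "z \<in> B" for z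
    using that funpow_orbit_sym[OF assms finite_atLeastAtMost] unfolding xy by metis
  then show "disjnt A B"
    using neq by (auto simp: disjnt_iff)
next
  show "{} \<notin> orbit_partition n g"
    unfolding orbit_partition_eq[OF assms] by blast
qed

text \<open>The orbit of \<open>x\<close> under \<open>g\<close> is a block of the common partition
  containing \<open>x\<close>, and only one orbit of \<open>h\<close> contains
  \<open>x\<close>.\<close>

lemma orbit_partition_eq_imp_orbits_eq:
  assumes "g permutes {1..n}" "h permutes {1..n}"
    and "orbit_partition n g = orbit_partition n h" "x \<in> {1..n}"
  shows "range (\<lambda>k. (g ^^ k) x) = range (\<lambda>k. (h ^^ k) x)"
proof -
  have "range (\<lambda>k. (g ^^ k) x) \<in> orbit_partition n h"
    unfolding assms(3)[symmetric] orbit_partition_eq[OF assms(1)] using assms(4) by blast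
  then obtain y where y: "range (\<lambda>k. (g ^^ k) x) = range (\<lambda>k. (h ^^ k) y)"
    unfolding orbit_partition_eq[OF assms(2)] by blast
  moreover have "x \<in> range (\<lambda>k. (g ^^ k) x)"
    by (metis funpow_0 rangeI)
  ultimately show ?thesis
    using funpow_orbit_sym[OF assms(2) finite_atLeastAtMost, of x y] by simp
qed

lemma image_orbit_partition:
  assumes "g permutes {1..n}" "B \<in> orbit_partition n g"
  shows "g ` B = B"
proof (rule endo_inj_surj)
  show "finite B"
    using partition_onD1[OF partition_on_orbit_partition[OF assms(1)]] assms(2)
    by (metis Union_upper finite_atLeastAtMost finite_subset)
  obtain x where "B = range (\<lambda>k. (g ^^ k) x)"
    using assms(2) unfolding orbit_partition_eq[OF assms(1)] by blast
  then show "g ` B \<subseteq> B"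
    by (metis (no_types, lifting) funpow.simps(2) comp_apply image_subsetI rangeE rangeI)
  show "inj_on g B"
    using permutes_inj[OF assms(1)] by (rule inj_on_subset) simp
qed

text \<open>Iterates of a point never leave an invariant block. This is the link from the blockwise
  stabilizer to the refinement order, where minimality can be applied.\<close>

lemma refines_orbit_partition:
  assumes "g permutes {1..n}" "partition_on {1..n} \<pi>" "\<And>B. B \<in> \<pi> \<Longrightarrow> g ` B = B"
  shows "refines {1..n} (orbit_partition n g) \<pi>"
  unfolding refines_def
proof (intro conjI ballI)
  fix X assume "X \<in> orbit_partition n g"
  then obtain x where x: "x \<in> {1..n}" "X = range (\<lambda>k. (g ^^ k) x)"
    unfolding orbit_partition_eq[OF assms(1)] by blast
  then obtain B where B: "B \<in> \<pi>" "x \<in> B"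
    using partition_onD1[OF assms(2)] by blast
  have "(g ^^ k) x \<in> B" for k
    using assms(3)[OF B(1)] B(2) by (induction k) auto
  then show "\<exists>Y\<in>\<pi>. X \<subseteq> Y" using x B by blast
qed (use assms partition_on_orbit_partition in auto)

section \<open>Blockwise stabilizers, and a criterion for prime powers\<close>

lemma subgroup_blockwise_stabilizer:
  assumes "subgroup G (sym_group n)"
  shows "subgroup (blockwise_stabilizer G \<pi>) (perm_group n G)"
proof -
  interpret P: group "perm_group n G"
    using group.subgroup_imp_group[OF sym_group_is_group assms] .
  show ?thesis
  proof (rule P.subgroupI)
    have "id \<in> G" using P.one_closed by (simp add: sym_group_def)
    then have "id \<in> blockwise_stabilizer G \<pi>" by (simp add: blockwise_stabilizer_def)
    then show "blockwise_stabilizer G \<pi> \<noteq> {}" by blast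
    fix a assume a: "a \<in> blockwise_stabilizer G \<pi>"
    then have aG: "a \<in> carrier (perm_group n G)" by (simp add: blockwise_stabilizer_def)
    let ?i = "inv\<^bsub>perm_group n G\<^esub> a"
    have inv: "?i \<circ> a = id"
      using P.l_inv[OF aG] by (simp only: perm_group_mult perm_group_one)
    have "?i ` B = B" if "B \<in> \<pi>" for B
    proof -
      have "a ` B = B" using a that by (simp add: blockwise_stabilizer_def)
      then have "?i ` B = (?i \<circ> a) ` B" by (simp only: image_comp[symmetric])
      then show ?thesis by (simp add: inv)
    qed
    then show "?i \<in> blockwise_stabilizer G \<pi>"
      using P.inv_closed[OF aG] by (simp add: blockwise_stabilizer_def)
    fix b assume b: "b \<in> blockwise_stabilizer G \<pi>"
    then have "a \<otimes>\<^bsub>perm_group n G\<^esub> b \<in> G"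
      using P.m_closed[OF aG, of b] by (simp add: blockwise_stabilizer_def)
    moreover have "(a \<circ> b) ` B = B" if "B \<in> \<pi>" for B
    proof -
      have "a ` b ` B = B" using a b that by (simp add: blockwise_stabilizer_def)
      then show ?thesis by (simp only: image_comp)
    qed
    ultimately show "a \<otimes>\<^bsub>perm_group n G\<^esub> b \<in> blockwise_stabilizer G \<pi>"
      unfolding blockwise_stabilizer_def perm_group_mult by blast
  qed (auto simp: blockwise_stabilizer_def)
qed

text \<open>Strong induction, splitting off one factor \<open>p\<close> at a time. Primality of
  \<open>p\<close> is not assumed: for \<open>m = 1\<close> the exponent is 0, and otherwise some
  prime divisor of \<open>m\<close> must be \<open>p\<close>.\<close>

lemma nat_eq_prime_power:
  fixes m p :: nat
  assumes "m \<noteq> 0" "\<And>q. prime q \<Longrightarrow> q dvd m \<Longrightarrow> q = p"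
  shows "\<exists>k. m = p ^ k"
  using assms
proof (induction m rule: less_induct)
  case (less m)
  show ?case
  proof (cases "m = 1")
    case True
    then show ?thesis by (intro exI[of _ 0]) simp
  next
    case False
    then obtain q where q: "prime q" "q dvd m" using prime_factor_nat by blast
    then obtain l where l: "m = p * l" using less.prems(2) by blast
    have "p > 1" using less.prems(2) q prime_gt_1_nat by blast
    then have "l < m" "l \<noteq> 0" using l less.prems(1) by auto
    then obtain k where "l = p ^ k" using less.IH[of l] less.prems(2) l by auto
    then show ?thesis using l by (intro exI[of _ "Suc k"]) simp
  qed
qed

section \<open>The image of the stabilizer of a minimal partition\<close>

context
  fixes n :: nat and G N :: "(nat \<Rightarrow> nat) set" and \<pi> :: "nat set set"
  assumes G: "subgroup G (sym_group n)"
    and N: "N \<lhd> perm_group n G"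
    and minimal: "minimal_partition n (orbit_partition n ` (G - N)) \<pi>"
begin

interpretation P: group "perm_group n G"
  using group.subgroup_imp_group[OF sym_group_is_group G] .

interpretation N: normal N "perm_group n G"
  by (rule N)

interpretation M: group "perm_group n G Mod N"
  by (rule N.factorgroup_is_group)

lemma permutes_of_mem: "g \<in> G \<Longrightarrow> g permutes {1..n}"
  using subgroup.mem_carrier[OF G] sym_group_carrier by blast

lemma finite_of_subgroup_sym: "finite G"
  using finite_subset[OF subgroup.subset[OF G] finite_sym_group] .

lemma partition_on_minimal: "partition_on {1..n} \<pi>"
  using minimal partition_on_orbit_partition permutes_of_mem
  unfolding minimal_partition_def by auto

lemma orbit_partition_of_stabilizer:
  assumes "h \<in> blockwise_stabilizer G \<pi>" "h \<notin> N"
  shows "orbit_partition n h = \<pi>"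
proof -
  have h: "h \<in> G - N" "\<And>B. B \<in> \<pi> \<Longrightarrow> h ` B = B"
    using assms by (auto simp: blockwise_stabilizer_def)
  then show ?thesis
    using minimal refines_orbit_partition[OF permutes_of_mem partition_on_minimal, of h]
    unfolding minimal_partition_def by blast
qed

context
  fixes g
  assumes g: "g \<in> G" "g \<notin> N" "orbit_partition n g = \<pi>"
begin

text \<open>Used in contrapositive form too: a stabilizer element whose orbit at a single point
  differs from that of \<open>g\<close> must lie in \<open>N\<close>.\<close>

lemma orbits_of_stabilizer:
  assumes "h \<in> blockwise_stabilizer G \<pi>" "h \<notin> N" "x \<in> {1..n}"
  shows "range (\<lambda>k. (h ^^ k) x) = range (\<lambda>k. (g ^^ k) x)"
proof (rule orbit_partition_eq_imp_orbits_eq)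
  show "h permutes {1..n}"
    using assms(1) permutes_of_mem by (simp add: blockwise_stabilizer_def)
qed (use assms g permutes_of_mem orbit_partition_of_stabilizer in auto)

lemma generator_in_stabilizer: "g \<in> blockwise_stabilizer G \<pi>"
  using g image_orbit_partition[OF permutes_of_mem] by (simp add: blockwise_stabilizer_def)

lemma pow_in_stabilizer: "g ^^ k \<in> blockwise_stabilizer G \<pi>"
proof -
  interpret H: subgroup "blockwise_stabilizer G \<pi>" "perm_group n G"
    by (rule subgroup_blockwise_stabilizer[OF G])
  show ?thesis
  proof (induction k)
    case 0
    then show ?case using H.one_closed by (simp only: perm_group_one funpow.simps)
  next
    case (Suc k)
    then show ?case
      using H.m_closed[OF generator_in_stabilizer Suc] by (simp only: perm_group_mult funpow.simps)
  qed
qed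

lemma generator_neq_id: "g \<noteq> id"
  using g(2) N.one_closed by (auto simp: perm_group_one)

lemma generate_eq_image:
  "generate (perm_group n G Mod N) {N #>\<^bsub>perm_group n G\<^esub> g} =
    (\<lambda>h. N #>\<^bsub>perm_group n G\<^esub> h) ` blockwise_stabilizer G \<pi>" (is "?L = ?R")
proof -
  have Ng: "N #>\<^bsub>perm_group n G\<^esub> g \<in> carrier (perm_group n G Mod N)"
    using g(1) by (auto simp: carrier_FactGroup)
  have fin: "finite (carrier (perm_group n G Mod N))"
    using finite_of_subgroup_sym by (simp add: carrier_FactGroup)
  have pow: "(N #>\<^bsub>perm_group n G\<^esub> g) [^]\<^bsub>perm_group n G Mod N\<^esub> k
      = N #>\<^bsub>perm_group n G\<^esub> (g ^^ k)" for k :: nat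
    using N.FactGroup_pow[of g k] g(1) by (simp add: perm_group_pow)
  have L: "?L = range (\<lambda>k. N #>\<^bsub>perm_group n G\<^esub> (g ^^ k))"
    unfolding M.generate_pow_on_finite_carrier[OF fin Ng] pow by auto
  obtain x where x: "g x \<noteq> x" using generator_neq_id by fastforce
  then have xn: "x \<in> {1..n}" using permutes_of_mem[OF g(1)] permutes_not_in by metis
  have "N #>\<^bsub>perm_group n G\<^esub> h \<in> ?L" if h: "h \<in> blockwise_stabilizer G \<pi>" for h
  proof -
    interpret H: subgroup "blockwise_stabilizer G \<pi>" "perm_group n G"
      by (rule subgroup_blockwise_stabilizer[OF G])
    \<comment> \<open>The block of \<open>x\<close> is its orbit under \<open>g\<close>. As
      \<open>h\<close> preserves this block, \<open>h x\<close> is reached from \<open>x\<close> by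
      a power of \<open>g\<close>.\<close>
    have "range (\<lambda>k. (g ^^ k) x) \<in> \<pi>"
      using g(3) orbit_partition_eq[OF permutes_of_mem[OF g(1)]] xn by blast
    then have "h ` range (\<lambda>k. (g ^^ k) x) = range (\<lambda>k. (g ^^ k) x)"
      using h by (simp add: blockwise_stabilizer_def)
    then have "h x \<in> range (\<lambda>k. (g ^^ k) x)"
      by (metis (mono_tags, lifting) funpow_0 imageI rangeI)
    then obtain i where i: "h x = (g ^^ i) x" by blast
    define a where "a = g ^^ i"
    have a: "a \<in> blockwise_stabilizer G \<pi>" unfolding a_def by (rule pow_in_stabilizer)
    define u where "u = inv\<^bsub>perm_group n G\<^esub> a \<otimes>\<^bsub>perm_group n G\<^esub> h"
    have u: "u \<in> blockwise_stabilizer G \<pi>" unfolding u_def by (intro H.m_closed H.m_inv_closed a h)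
    have hu: "h = a \<otimes>\<^bsub>perm_group n G\<^esub> u"
      unfolding u_def using H.mem_carrier[OF a] H.mem_carrier[OF h]
      by (metis P.inv_closed P.m_assoc P.r_inv P.l_one)
    have "inj a"
      using a permutes_of_mem permutes_inj by (auto simp: blockwise_stabilizer_def)
    moreover have "a (u x) = a x"
      using hu i by (simp add: sym_group_mult a_def)
    ultimately have ux: "u x = x" by (simp add: inj_eq)
    \<comment> \<open>The orbit of \<open>x\<close> is a singleton under \<open>u\<close> but
      contains \<open>g x\<close>, different from \<open>x\<close>, under \<open>g\<close>. Hence
      \<open>u\<close> cannot lie outside \<open>N\<close>.\<close>
    have "(u ^^ k) x = x" for k by (induction k) (simp_all add: ux)
    moreover have "g x \<in> range (\<lambda>k. (g ^^ k) x)"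
      using rangeI[of "\<lambda>k. (g ^^ k) x" 1] by simp
    ultimately have "u \<in> N"
      using orbits_of_stabilizer[OF u _ xn] x by auto
    then have Nu: "N #>\<^bsub>perm_group n G\<^esub> u = \<one>\<^bsub>perm_group n G Mod N\<^esub>"
      using P.coset_join2[OF H.mem_carrier[OF u] N.subgroup_axioms] by (simp add: FactGroup_def)
    have "N #>\<^bsub>perm_group n G\<^esub> h = (N #>\<^bsub>perm_group n G\<^esub> a)
        \<otimes>\<^bsub>perm_group n G Mod N\<^esub> (N #>\<^bsub>perm_group n G\<^esub> u)"
      unfolding hu using N.rcos_sum[OF H.mem_carrier[OF a] H.mem_carrier[OF u]]
      by (simp add: FactGroup_def)
    also have "\<dots> = N #>\<^bsub>perm_group n G\<^esub> a"
      unfolding Nu by (rule M.r_one) (use H.mem_carrier[OF a] in \<open>auto simp: carrier_FactGroup\<close>)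
    finally show ?thesis unfolding L a_def by blast
  qed
  then show ?thesis
    unfolding L using pow_in_stabilizer by blast
qed

text \<open>If \<open>g\<^sup>q \<notin> N\<close>, then \<open>g\<^sup>q\<close> has the same orbits as \<open>g\<close>, so \<open>g\<close> agrees
  at each point with a power of \<open>g\<^sup>q\<close>, and \<open>g\<close> to the power \<open>ord g / q\<close> fixes every point.\<close>

lemma ord_coset_eq:
  assumes q: "prime q" "q dvd P.ord g"
  shows "M.ord (N #>\<^bsub>perm_group n G\<^esub> g) = q"
proof -
  have gc: "g \<in> carrier (perm_group n G)" using g(1) by simp
  obtain r where r: "P.ord g = q * r" using q(2) by blast
  have one: "g ^^ (q * r) = id"
    using P.pow_ord_eq_1[OF gc] by (simp add: r perm_group_pow perm_group_one)
  have "g ^^ q \<in> N"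
  proof (rule ccontr)
    assume nN: "g ^^ q \<notin> N"
    have "(g ^^ r) x = x" for x
    proof (cases "x \<in> {1..n}")
      case True
      have "g x \<in> range (\<lambda>k. (g ^^ k) x)"
        using rangeI[of "\<lambda>k. (g ^^ k) x" 1] by simp
      then obtain j where "g x = ((g ^^ q) ^^ j) x"
        using orbits_of_stabilizer[OF pow_in_stabilizer nN True] by auto
      then have gx: "g x = (g ^^ (q * j)) x" by (simp add: funpow_mult mult.commute)
      \<comment> \<open>The relation at \<open>x\<close> alone propagates along the orbit because
        powers of \<open>g\<close> commute. Taking \<open>i = r\<close> makes the right-hand
        exponent a multiple of the order \<open>q * r\<close>.\<close>
      have pow: "(g ^^ i) x = (g ^^ (q * j * i)) x" for i
      proof (induction i)
        case (Suc i)
        have "(g ^^ Suc i) x = (g ^^ i) (g x)" by (simp add: funpow_swap1)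
        also have "\<dots> = (g ^^ (q * j)) ((g ^^ i) x)"
          unfolding gx by (metis add.commute comp_apply funpow_add)
        also have "\<dots> = (g ^^ (q * j * Suc i)) x"
          unfolding Suc by (simp add: funpow_add)
        finally show ?case .
      qed simp
      have "(g ^^ r) x = (g ^^ (q * r * j)) x" using pow[of r] by (simp only: mult_ac)
      also have "g ^^ (q * r * j) = id" 
        by (simp add: one flip: funpow_mult[of j])
      finally show ?thesis by simp
    next
      case False
      then show ?thesis
        using funpow_permutes[OF permutes_of_mem[OF g(1)]] permutes_not_in by metis
    qed
    then have "g [^]\<^bsub>perm_group n G\<^esub> r = \<one>\<^bsub>perm_group n G\<^esub>"
      by (simp add: fun_eq_iff perm_group_pow perm_group_one)
    then have "q * r dvd r" using P.pow_eq_id[OF gc] r by simp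
    moreover have "r > 0"
      using P.ord_ge_1[OF _ gc] finite_of_subgroup_sym r by (cases r) auto
    ultimately show False
      using prime_gt_1_nat[OF q(1)] by (simp add: nat_dvd_not_less)
  qed
  then have "(N #>\<^bsub>perm_group n G\<^esub> g) [^]\<^bsub>perm_group n G Mod N\<^esub> q = \<one>\<^bsub>perm_group n G Mod N\<^esub>"
    unfolding N.FactGroup_pow[OF gc] perm_group_pow
    using P.coset_join2[OF _ N.subgroup_axioms] N.mem_carrier by (simp add: FactGroup_def)
  moreover have Ng: "N #>\<^bsub>perm_group n G\<^esub> g \<in> carrier (perm_group n G Mod N)"
    using g(1) by (auto simp: carrier_FactGroup)
  ultimately have "M.ord (N #>\<^bsub>perm_group n G\<^esub> g) dvd q"
    using M.pow_eq_id by blast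
  \<comment> \<open>Order 1 would make the coset of \<open>g\<close> trivial, contradicting
    \<open>g \<notin> N\<close>. So the order, a divisor of the prime \<open>q\<close>, is
    \<open>q\<close> itself.\<close>
  moreover have "M.ord (N #>\<^bsub>perm_group n G\<^esub> g) \<noteq> 1"
  proof
    assume "M.ord (N #>\<^bsub>perm_group n G\<^esub> g) = 1"
    then have "N #>\<^bsub>perm_group n G\<^esub> g = N"
      unfolding M.ord_eq_1[OF Ng] by (simp add: FactGroup_def)
    then show False
      using P.coset_join1[OF _ gc N.subgroup_axioms] g(2) by blast
  qed
  ultimately show ?thesis using q(1) by (metis prime_nat_iff)
qed

lemma prime_ord_coset: "prime (M.ord (N #>\<^bsub>perm_group n G\<^esub> g))"
proof -
  have "\<exists>q. prime q \<and> q dvd P.ord g"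
    using P.ord_eq_1[of g] g(1) generator_neq_id prime_factor_nat by (simp add: perm_group_one)
  then show ?thesis using ord_coset_eq by auto
qed

text \<open>Every prime divisor of the order of \<open>g\<close> equals the order of one and the
  same coset, so there is only one such prime.\<close>

lemma ord_eq_prime_power: "\<exists>k. P.ord g = M.ord (N #>\<^bsub>perm_group n G\<^esub> g) ^ k"
proof (rule nat_eq_prime_power)
  show "P.ord g \<noteq> 0" using P.ord_ge_1[of g] g(1) finite_of_subgroup_sym by auto
qed (rule ord_coset_eq[symmetric])

text \<open>An equality of structures, not just of carriers, so that facts about cyclic generated
  subgroups transfer. \<open>subgroup_generated\<close> intersects its generators with the carrier,
  which changes nothing for a coset of \<open>g\<close>.\<close>

lemma quotient_image_eq_subgroup_generated:
  "quotient_image (perm_group n G) N (blockwise_stabilizer G \<pi>) =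
    subgroup_generated (perm_group n G Mod N) {N #>\<^bsub>perm_group n G\<^esub> g}"
proof -
  have "carrier (perm_group n G Mod N) \<inter> {N #>\<^bsub>perm_group n G\<^esub> g} = {N #>\<^bsub>perm_group n G\<^esub> g}"
    using g(1) by (auto simp: carrier_FactGroup)
  then show ?thesis
    unfolding quotient_image_def subgroup_generated_def
    using generate_eq_image by simp
qed

lemma order_quotient_image:
  "order (quotient_image (perm_group n G) N (blockwise_stabilizer G \<pi>)) =
    M.ord (N #>\<^bsub>perm_group n G\<^esub> g)"
proof -
  have "N #>\<^bsub>perm_group n G\<^esub> g \<in> carrier (perm_group n G Mod N)"
    using g(1) by (auto simp: carrier_FactGroup)
  then show ?thesis
    unfolding quotient_image_eq_subgroup_generated by (rule M.cyclic_order_is_ord[symmetric])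
qed

end

end

theorem lemma4p5:
  fixes n :: nat and G N :: "(nat \<Rightarrow> nat) set" and \<pi> :: "nat set set"
  assumes "subgroup G (sym_group n)"
    and "N \<lhd> perm_group n G"
    and "N \<noteq> G"
    and "minimal_partition n (orbit_partition n ` (G - N)) \<pi>"
  shows "\<exists>p::nat. prime p \<and>
    cyclic_group (quotient_image (perm_group n G) N (blockwise_stabilizer G \<pi>)) \<and>
    order (quotient_image (perm_group n G) N (blockwise_stabilizer G \<pi>)) = p \<and>
    (\<forall>g\<in>G - N. orbit_partition n g = \<pi> \<longrightarrow>
      (\<exists>k::nat. group.ord (perm_group n G) g = p ^ k) \<and>
      generate (perm_group n G Mod N) {N #>\<^bsub>perm_group n G\<^esub> g} =
        carrier (quotient_image (perm_group n G) N (blockwise_stabilizer G \<pi>)))"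
proof (rule exI[of _ "order (quotient_image (perm_group n G) N (blockwise_stabilizer G \<pi>))"],
    intro conjI ballI impI refl)
  note ctx = assms(1,2,4)
  interpret M: group "perm_group n G Mod N"
    by (rule normal.factorgroup_is_group[OF assms(2)])
  \<comment> \<open>A minimal partition belongs to the set, so it is realized by some
    \<open>g\<close> outside \<open>N\<close>. Any such \<open>g\<close> proves cyclicity and
    primality.\<close>
  obtain g where g: "g \<in> G" "g \<notin> N" "orbit_partition n g = \<pi>"
    using assms(4) unfolding minimal_partition_def by blast
  show "prime (order (quotient_image (perm_group n G) N (blockwise_stabilizer G \<pi>)))"
    unfolding order_quotient_image[OF ctx g] by (rule prime_ord_coset[OF ctx g])
  show "cyclic_group (quotient_image (perm_group n G) N (blockwise_stabilizer G \<pi>))"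
    unfolding quotient_image_eq_subgroup_generated[OF ctx g] by (rule M.cyclic_group_generated)
next
  note ctx = assms(1,2,4)
  fix g assume "g \<in> G - N" and "orbit_partition n g = \<pi>"
  then have g: "g \<in> G" "g \<notin> N" "orbit_partition n g = \<pi>" by auto
  \<comment> \<open>The witness for \<open>p\<close> is the order of the image, which does not
    mention \<open>g\<close>, so the same prime serves every \<open>g\<close>.\<close>
  show "\<exists>k. group.ord (perm_group n G) g =
      order (quotient_image (perm_group n G) N (blockwise_stabilizer G \<pi>)) ^ k"
    unfolding order_quotient_image[OF ctx g] by (rule ord_eq_prime_power[OF ctx g])
  show "generate (perm_group n G Mod N) {N #>\<^bsub>perm_group n G\<^esub> g} =
      carrier (quotient_image (perm_group n G) N (blockwise_stabilizer G \<pi>))"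
    using generate_eq_image[OF ctx g] by (simp add: quotient_image_def)
qed

end
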